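(* Let the cells of the integer grid be colored by the column-alternating coloring. For every positive integer $n$, the number of black-white balanced Dyck paths of semilength $n$ (with respect to the column-alternating coloring) is given by \[ \begin{cases} \frac{1}{2m+1}\binom{3m}{m}, & \text{if } n=2m,\\ \frac{1}{m+1}\binom{3m+1}{m}, & \text{if } n=2m+1, \end{cases} \] where $m$ is a nonnegative integer. In particular, the proportion of black-white balanced Dyck paths among all Dyck paths of semilength $n$ is asymptotically $\beta\alpha^n$ as $n\to\infty$ (that is, the ratio of this proportion to $\beta\alpha^n$ tends to $1$), where $\alpha=3\sqrt{3}/8$, and $\beta=\sqrt{3/2}$ if $n$ is even and $\beta=\sqrt{2}$ if $n$ is odd.
   Context: For a positive integer $n$, a Dyck path of semilength $n$ is a lattice path from $(0,0)$ to $(n,n)$ consisting of $n$ right-steps $(1,0)$ and $n$ up-steps $(0,1)$ that never rises above the line $y=x$. The total number of Dyck paths of semilength $n$ is the Catalan number $C_n=\frac{1}{n+1}\binom{2n}{n}$. The cells of the integer grid are the unit squares; the $i$th column ($i\ge 1$) consists of the cells $[i-1,i]\times[j-1,j]$, $j\ge 1$. In the column-alternating coloring, all cells of the $i$th column are black if $i$ is odd and white otherwise. A cell lies below a Dyck path $p$ if it lies in the region between the $x$-axis and $p$; thus, in the $i$th column ($1\le i\le n$), the cells below $p$ are the bottom $p_i$ cells, where $p_i$ is the height ($y$-coordinate) of the $i$th right-step of $p$. Let $\mathrm{black}(p)$ and $\mathrm{white}(p)$ denote the numbers of black and white cells that lie below $p$. The path $p$ is called black-white balanced if $\mathrm{black}(p)=\mathrm{white}(p)$.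 *)

theory Defs
  imports Complex_Main
begin

datatype step = Right | Up  \<comment> \<open>right-step \<open>(1,0)\<close> and up-step \<open>(0,1)\<close>\<close>

text \<open>A lattice path starting at \<open>(0,0)\<close> is given by its list of steps;
  \<open>(x_after p k, y_after p k)\<close> is the lattice point reached after the first \<open>k\<close> steps.\<close>

definition x_after :: "step list \<Rightarrow> nat \<Rightarrow> nat" where
  "x_after p k = count_list (take k p) Right"

definition y_after :: "step list \<Rightarrow> nat \<Rightarrow> nat" where
  "y_after p k = count_list (take k p) Up"

text \<open>The steps are unit and axis-parallel, so a path never rises above the line \<open>y = x\<close>
  iff none of its lattice points does.\<close>

definition dyck_paths :: "nat \<Rightarrow> step list set" where
  "dyck_paths n = {p. x_after p (length p) = n \<and> y_after p (length p) = n \<and>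
                      (\<forall>k \<le> length p. y_after p k \<le> x_after p k)}"

text \<open>The pair \<open>(i, j)\<close> with \<open>i, j \<ge> 1\<close> denotes the cell \<open>[i-1,i] \<times> [j-1,j]\<close>.\<close>

type_synonym cell = "nat \<times> nat"

datatype colour = Black | White

definition column_alternating :: "cell \<Rightarrow> colour" where
  "column_alternating c = (if odd (fst c) then Black else White)"

text \<open>The right-step of \<open>p\<close> at list position \<open>k\<close> leads from \<open>(x_after p k, y_after p k)\<close> to
  \<open>(x_after p k + 1, y_after p k)\<close>, so it is the top boundary of the cells below \<open>p\<close> in
  column \<open>x_after p k + 1\<close>.\<close>

definition cells_below :: "step list \<Rightarrow> cell set" where
  "cells_below p = {(i, j). \<exists>k < length p. p ! k = Right \<and> i = x_after p k + 1 \<and>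
                                         1 \<le> j \<and> j \<le> y_after p k}"

definition black :: "(cell \<Rightarrow> colour) \<Rightarrow> step list \<Rightarrow> nat" where
  "black col p = card {c \<in> cells_below p. col c = Black}"

definition white :: "(cell \<Rightarrow> colour) \<Rightarrow> step list \<Rightarrow> nat" where
  "white col p = card {c \<in> cells_below p. col c = White}"

definition balanced_dyck_paths :: "(cell \<Rightarrow> colour) \<Rightarrow> nat \<Rightarrow> step list set" where
  "balanced_dyck_paths col n = {p \<in> dyck_paths n. black col p = white col p}"

definition balanced_proportion :: "(cell \<Rightarrow> colour) \<Rightarrow> nat \<Rightarrow> real" where
  "balanced_proportion col n =
     real (card (balanced_dyck_paths col n)) / real (card (dyck_paths n))"

end

theory Submission
  imports Defs "HOL-Probability.Characteristic_Functions" "HOL-Real_Asymp.Real_Asymp"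
begin

text \<open>Record a Dyck path by the heights \<open>p\<^sub>1 \<le> p\<^sub>2 \<le> \<dots> \<le> p\<^sub>n\<close> of its right-steps; the diagonal
  condition becomes \<open>p\<^sub>i \<le> i - 1\<close>, and black minus white is the alternating sum
  \<open>p\<^sub>1 - p\<^sub>2 + p\<^sub>3 - \<dots>\<close> (\<open>bij_betw_heights\<close>, \<open>black_minus_white\<close>). Pair up consecutive heights, leaving
  out \<open>p\<^sub>1 = 0\<close> when \<open>n\<close> is odd. Since the heights increase weakly, every pair contributes to this sum
  with the same sign, so the path is balanced iff the two heights in each pair agree
  (\<open>alt_sum_sorted_even_length\<close>). Keeping one height per pair leaves a weakly increasing sequence
  \<open>q\<^sub>0, \<dots>, q\<^sub>m\<^sub>-\<^sub>1\<close> under a staircase of slope 2, namely \<open>q\<^sub>j \<le> 2j\<close> for \<open>n = 2m\<close> and \<open>q\<^sub>j \<le> 2j + 1\<close> for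
  \<open>n = 2m + 1\<close>.

  Weakly increasing sequences of length \<open>k\<close> with \<open>q\<^sub>j < \<mu>j + r\<close> are counted by the Raney numbers
  \<open>r / (k(\<mu>+1) + r) \<cdot> binom(k(\<mu>+1) + r, k)\<close> (\<open>card_staircase_seqs\<close>): the recursion on the first entry is the
  one these numbers satisfy. The case \<open>\<mu> = 1\<close>, \<open>r = 1\<close> gives the Catalan numbers, and \<open>\<mu> = 2\<close> with
  \<open>r = 1\<close> and \<open>r = 2\<close> gives the two formulas for balanced paths.

  For the asymptotics, the factors \<open>2m + 1\<close> cancel in the proportion for \<open>n = 2m\<close>, which is
  \<open>(3m)! (2m)! / (m! (4m)!)\<close>. Splitting each factorial by residue classes turns this into \<open>(27/64)\<^sup>m\<close>
  times a ratio of rising factorials at \<open>1/3, 2/3\<close> and \<open>1/4, 3/4\<close>. By Euler's limit for the Gamma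
  function and the reflection formula that ratio tends to
  \<open>sin(\<pi>/3) / sin(\<pi>/4) = \<surd>(3/2)\<close>, so Stirling's formula can be avoided. The proportion
  for \<open>n = 2m + 1\<close> is the one for \<open>2m\<close> times \<open>(3m + 1)/(4m + 1)\<close>, which tends to \<open>3/4\<close>.\<close>

section \<open>Paths as height sequences\<close>

text \<open>The accumulator \<open>h\<close> is the height at which the path starts; it lets suffixes of a path be
  treated by induction.\<close>

fun heights :: "nat \<Rightarrow> step list \<Rightarrow> nat list" where
  "heights h [] = []"
| "heights h (Right # p) = h # heights h p"
| "heights h (Up # p) = heights (Suc h) p"

text \<open>The bound is strict so that \<open>r = 0\<close>, which leaves no room for a first entry, is available as
  the base case of the recursion below.\<close>

definition staircase_seqs :: "nat \<Rightarrow> nat \<Rightarrow> nat \<Rightarrow> nat list set" where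
  "staircase_seqs \<mu> r k = {q. length q = k \<and> sorted q \<and> (\<forall>j<k. q ! j < \<mu> * j + r)}"

lemma length_heights: "length (heights h p) = count_list p Right"
  by (induction h p rule: heights.induct) auto

lemma heights_ge: "v \<in> set (heights h p) \<Longrightarrow> h \<le> v"
  by (induction h p rule: heights.induct) (auto simp: Suc_le_eq)

lemma sorted_heights: "sorted (heights h p)"
  by (induction h p rule: heights.induct) (auto simp: heights_ge)

lemma heights_replicate_Up: "heights h (replicate k Up @ p) = heights (h + k) p"
  by (induction k arbitrary: h) auto

text \<open>The link with the position-based description of right-steps in which the cells below a path
  are given.\<close>

lemma nth_heights_iff:
  "i < length (heights h p) \<and> heights h p ! i = v \<longleftrightarrow>
     (\<exists>k<length p. p ! k = Right \<and> x_after p k = i \<and> h + y_after p k = v)"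
proof (induction h p arbitrary: i rule: heights.induct)
  case (2 h p)
  show ?case
    using "2.IH"[of "i - 1"]
    by (cases i) (auto simp: Ex_less_Suc2 x_after_def y_after_def)
next
  case (3 h p)
  show ?case
    using "3.IH"[of i] by (auto simp: Ex_less_Suc2 x_after_def y_after_def)
qed simp

lemma all_le_Suc_iff: "(\<forall>k\<le>Suc n. P k) \<longleftrightarrow> P 0 \<and> (\<forall>k\<le>n. P (Suc k))"
  using All_less_Suc2[of "Suc n" P] by (simp add: less_Suc_eq_le)

text \<open>A lattice point is dominated by the start of the next right-step, which has the same abscissa
  and is at least as high. So the diagonal can only be crossed before a right-step, except for points
  after the last one; these lie below the end point, which is what the assumption covers.\<close>

lemma below_diagonal_iff_heights:
  assumes "h + count_list p Up \<le> x + count_list p Right"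
  shows "(\<forall>k\<le>length p. h + y_after p k \<le> x + x_after p k) \<longleftrightarrow>
         (\<forall>i<length (heights h p). heights h p ! i \<le> x + i)"
  using assms
proof (induction h p arbitrary: x rule: heights.induct)
  case (1 h)
  then show ?case by (simp add: x_after_def y_after_def)
next
  case (2 h p)
  have "(\<forall>k\<le>length (Right # p). h + y_after (Right # p) k \<le> x + x_after (Right # p) k) \<longleftrightarrow>
      h \<le> x \<and> (\<forall>k\<le>length p. h + y_after p k \<le> Suc x + x_after p k)"
    by (simp add: all_le_Suc_iff x_after_def y_after_def)
  also have "\<dots> \<longleftrightarrow> h \<le> x \<and> (\<forall>i<length (heights h p). heights h p ! i \<le> Suc x + i)"
    using "2.IH"[of "Suc x"] "2.prems" by simp
  finally show ?case by (simp add: All_less_Suc2)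
next
  case (3 h p)
  have start: "h \<le> x" if "\<forall>k\<le>length p. Suc h + y_after p k \<le> x + x_after p k"
    using that[rule_format, of 0] by (simp add: x_after_def y_after_def)
  have "(\<forall>k\<le>length (Up # p). h + y_after (Up # p) k \<le> x + x_after (Up # p) k) \<longleftrightarrow>
      h \<le> x \<and> (\<forall>k\<le>length p. Suc h + y_after p k \<le> x + x_after p k)"
    by (simp add: all_le_Suc_iff x_after_def y_after_def)
  also have "\<dots> \<longleftrightarrow> (\<forall>k\<le>length p. Suc h + y_after p k \<le> x + x_after p k)"
    using start by blast
  also have "\<dots> \<longleftrightarrow> (\<forall>i<length (heights h (Up # p)). heights h (Up # p) ! i \<le> x + i)"
    using 3 by simp
  finally show ?case .
qed

text \<open>The heights do not see the up-steps after the last right-step, hence the second premise.\<close>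

lemma heights_inject:
  "heights h p = heights h p' \<Longrightarrow> count_list p Up = count_list p' Up \<Longrightarrow> p = p'"
proof (induction h p arbitrary: p' rule: heights.induct)
  case (1 h)
  then show ?case
    using length_heights[of h p'] by (cases "(h, p')" rule: heights.cases) auto
next
  case (2 h p)
  have "h # heights h p \<noteq> heights (Suc h) p''" for p''
    by (metis heights_ge list.set_intros(1) not_less_eq_eq order_refl)
  with 2 show ?case
    by (cases "(h, p')" rule: heights.cases) auto
next
  case (3 h p)
  have "h # heights h p'' \<noteq> heights (Suc h) p" for p''
    by (metis heights_ge list.set_intros(1) not_less_eq_eq order_refl)
  with 3 show ?case
    by (cases "(h, p')" rule: heights.cases) (force, force, auto)
qed

lemma count_list_replicate_self: "count_list (replicate k a) a = k"
  by (induction k) auto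

lemma ex_path_with_heights:
  "sorted q \<Longrightarrow> \<forall>v\<in>set q. h \<le> v \<and> v \<le> e \<Longrightarrow> h \<le> e \<Longrightarrow>
     \<exists>p. heights h p = q \<and> h + count_list p Up = e"
proof (induction q arbitrary: h)
  case Nil
  then show ?case
    using heights_replicate_Up[of h "e - h" "[]"]
    by (intro exI[of _ "replicate (e - h) Up"]) (simp add: count_list_replicate_self)
next
  case (Cons v q)
  then obtain p where p: "heights v p = q" "v + count_list p Up = e"
    by (metis list.set_intros sorted_simps(2))
  have "h \<le> v" using Cons.prems by simp
  with p show ?case
    by (intro exI[of _ "replicate (v - h) Up @ Right # p"])
      (simp add: heights_replicate_Up count_list_replicate_self)
qed

lemma bij_betw_heights: "bij_betw (heights 0) (dyck_paths n) (staircase_seqs 1 1 n)"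
proof (rule bij_betw_imageI)
  show "inj_on (heights 0) (dyck_paths n)"
    by (intro inj_onI heights_inject) (auto simp: dyck_paths_def y_after_def)
  have dyck_iff: "p \<in> dyck_paths n \<longleftrightarrow>
      count_list p Right = n \<and> count_list p Up = n \<and> heights 0 p \<in> staircase_seqs 1 1 n" for p
    using below_diagonal_iff_heights[of 0 p 0]
    by (auto simp: dyck_paths_def staircase_seqs_def length_heights sorted_heights
        x_after_def y_after_def less_Suc_eq_le)
  have "\<exists>p\<in>dyck_paths n. heights 0 p = q" if q: "q \<in> staircase_seqs 1 1 n" for q
  proof -
    have "\<forall>v\<in>set q. v \<le> n"
      using q by (fastforce simp: staircase_seqs_def in_set_conv_nth)
    then obtain p where p: "heights 0 p = q" "count_list p Up = n"
      using ex_path_with_heights[of q 0 n] q by (auto simp: staircase_seqs_def)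
    with q have "p \<in> dyck_paths n"
      using length_heights[of 0 p] unfolding dyck_iff by (simp add: staircase_seqs_def)
    with p show ?thesis by blast
  qed
  then show "heights 0 ` dyck_paths n = staircase_seqs 1 1 n"
    using dyck_iff by auto
qed

section \<open>Counting staircase sequences\<close>

lemma staircase_seqs_0: "staircase_seqs \<mu> r 0 = {[]}"
  by (auto simp: staircase_seqs_def)

lemma staircase_seqs_bound_0: "staircase_seqs \<mu> 0 (Suc k) = {}"
  by (force simp: staircase_seqs_def)

text \<open>A sequence either starts with 0, and its tail then lives under a staircase that begins one step
  of height \<open>\<mu>\<close> further up, or it is positive throughout and can be lowered by 1.\<close>

lemma staircase_seqs_Suc:
  "staircase_seqs \<mu> (Suc r) (Suc k) =
     (#) 0 ` staircase_seqs \<mu> (Suc r + \<mu>) k \<union> map Suc ` staircase_seqs \<mu> r (Suc k)"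
proof (intro equalityI subsetI)
  fix q assume q: "q \<in> staircase_seqs \<mu> (Suc r) (Suc k)"
  then obtain v q' where q_eq: "q = v # q'" by (cases q) (auto simp: staircase_seqs_def)
  show "q \<in> (#) 0 ` staircase_seqs \<mu> (Suc r + \<mu>) k \<union> map Suc ` staircase_seqs \<mu> r (Suc k)"
  proof (cases "v = 0")
    case True
    with q q_eq show ?thesis
      by (auto simp: staircase_seqs_def All_less_Suc2 algebra_simps)
  next
    case False
    then have pos: "\<forall>w\<in>set q. 0 < w" using q q_eq by (auto simp: staircase_seqs_def)
    then have q_map: "q = map Suc (map (\<lambda>w. w - 1) q)"
      by (simp add: map_idI)
    moreover have "map (\<lambda>w. w - 1) q \<in> staircase_seqs \<mu> r (Suc k)"
    proof -
      have "q ! j - 1 < \<mu> * j + r" if "j < Suc k" for j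
      proof -
        have "0 < q ! j" using pos q that by (auto simp: staircase_seqs_def)
        moreover have "q ! j < \<mu> * j + Suc r" using q that by (auto simp: staircase_seqs_def)
        ultimately show ?thesis by linarith
      qed
      moreover have "sorted (map (\<lambda>w. w - 1) q)"
        using q by (auto simp: staircase_seqs_def sorted_iff_nth_mono intro: diff_le_mono)
      ultimately show ?thesis using q by (auto simp: staircase_seqs_def simp del: nth_Cons_Suc)
    qed
    ultimately show ?thesis by blast
  qed
next
  fix q assume "q \<in> (#) 0 ` staircase_seqs \<mu> (Suc r + \<mu>) k \<union> map Suc ` staircase_seqs \<mu> r (Suc k)"
  then show "q \<in> staircase_seqs \<mu> (Suc r) (Suc k)"
    by (auto simp: staircase_seqs_def All_less_Suc2 algebra_simps sorted_iff_nth_mono nth_Cons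
        split: nat.splits)
qed

text \<open>The Raney numbers satisfy the recursion \<open>A(k+1, r+1) = A(k, r+1+\<mu>) + A(k+1, r)\<close> that the
  decomposition by the first entry yields. The equation is multiplied out to avoid division; for
  \<open>k = r = 0\<close> it is trivial, and for all other parameters it determines the cardinality. Finiteness
  belongs to the same induction because the cardinalities of the two parts are to be added.\<close>

lemma card_staircase_seqs:
  "finite (staircase_seqs \<mu> r k) \<and>
   (k * Suc \<mu> + r) * card (staircase_seqs \<mu> r k) = r * ((k * Suc \<mu> + r) choose k)"
proof (induction k arbitrary: r)
  case 0
  show ?case by (simp add: staircase_seqs_0)
next
  case (Suc k)
  note shorter = Suc.IH
  show ?case
  proof (induction r)
    case 0
    show ?case by (simp add: staircase_seqs_bound_0)
  next
    case (Suc r)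
    define N where "N = Suc k * Suc \<mu> + r"
    define A where "A = card (staircase_seqs \<mu> r (Suc k))"
    define B where "B = card (staircase_seqs \<mu> (Suc r + \<mu>) k)"
    have A: "N * A = r * (N choose Suc k)"
      using Suc.IH by (simp add: N_def A_def)
    have "k * Suc \<mu> + (Suc r + \<mu>) = N" by (simp add: N_def)
    then have B: "N * B = (r + Suc \<mu>) * (N choose k)"
      using shorter[of "Suc r + \<mu>"] by (simp add: B_def)
    have card_eq: "card (staircase_seqs \<mu> (Suc r) (Suc k)) = B + A"
      unfolding staircase_seqs_Suc A_def B_def
      using Suc.IH shorter
      by (subst card_Un_disjoint) (auto simp: card_image inj_on_subset[OF _ subset_UNIV])
    have absorb: "Suc k * (Suc N choose Suc k) = Suc N * (N choose k)"
      by (rule Suc_times_binomial)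
    (* The factor N is cancelled at the end: the recursion only determines N * A and N * B. *)
    have "N * (Suc N * (B + A)) = Suc N * (N * B + N * A)" by (simp add: algebra_simps)
    also have "\<dots> = Suc N * (r * (Suc N choose Suc k)) + Suc \<mu> * (Suc N * (N choose k))"
      unfolding A B by (simp add: algebra_simps)
    also have "\<dots> = (Suc N * r + Suc \<mu> * Suc k) * (Suc N choose Suc k)"
      unfolding absorb[symmetric] by (simp only: algebra_simps)
    also have "Suc N * r + Suc \<mu> * Suc k = N * Suc r"
      by (simp add: N_def algebra_simps)
    finally have "N * (Suc N * (B + A)) = N * (Suc r * (Suc N choose Suc k))"
      by (simp only: mult.assoc)
    moreover have "N \<noteq> 0" by (simp add: N_def)
    ultimately have "Suc N * (B + A) = Suc r * (Suc N choose Suc k)"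
      by (simp only: mult_cancel1 simp_thms)
    then show ?case
      using Suc.IH shorter card_eq
      by (auto simp: staircase_seqs_Suc N_def)
  qed
qed


text \<open>With \<open>M = k(\<mu>+1) + r\<close>, the identity \<open>(M + 1 - k) binom(M+1, k) = (M + 1) binom(M, k)\<close> removes the
  factor \<open>M + 1\<close>. This is the form in which the Catalan numbers and the formulas for balanced paths
  appear directly.\<close>

lemma card_staircase_seqs_reduced:
  "(\<mu> * k + Suc r) * card (staircase_seqs \<mu> (Suc r) k) = Suc r * ((Suc \<mu> * k + r) choose k)"
proof -
  define M where "M = Suc \<mu> * k + r"
  have "k * Suc \<mu> + Suc r = Suc M" by (simp add: M_def)
  then have raney: "Suc M * card (staircase_seqs \<mu> (Suc r) k) = Suc r * (Suc M choose k)"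
    using card_staircase_seqs[of \<mu> "Suc r" k] by simp
  have absorb: "(\<mu> * k + Suc r) * (Suc M choose k) = Suc M * (M choose k)"
    using binomial_absorb_comp[of "Suc M" k] by (simp add: M_def)
  have "Suc M * ((\<mu> * k + Suc r) * card (staircase_seqs \<mu> (Suc r) k)) =
      (\<mu> * k + Suc r) * (Suc M * card (staircase_seqs \<mu> (Suc r) k))"
    by (rule mult.left_commute)
  also have "\<dots> = Suc r * ((\<mu> * k + Suc r) * (Suc M choose k))"
    unfolding raney by (rule mult.left_commute)
  also have "\<dots> = Suc M * (Suc r * (M choose k))"
    unfolding absorb by (rule mult.left_commute)
  finally show ?thesis
    by (simp only: mult_cancel1 M_def) simp
qed

section \<open>Balanced paths as repeated heights\<close>

fun alt_sum :: "nat list \<Rightarrow> int" where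
  "alt_sum [] = 0"
| "alt_sum (v # q) = int v - alt_sum q"

lemma alt_sum_eq_diff:
  "alt_sum q = (\<Sum>i | i < length q \<and> even i. int (q ! i)) - (\<Sum>i | i < length q \<and> odd i. int (q ! i))"
proof -
  have "alt_sum q = (\<Sum>i<length q. (- 1) ^ i * int (q ! i))"
    by (induction q) (simp_all add: sum.lessThan_Suc_shift sum_negf del: sum.lessThan_Suc)
  also have "\<dots> = (\<Sum>i<length q. if even i then int (q ! i) else - int (q ! i))"
    by (intro sum.cong) auto
  finally show ?thesis
    by (simp add: sum.If_cases sum_negf Int_def)
qed

lemma card_cells_below_columns:
  "card {c \<in> cells_below p. P (fst c)} = (\<Sum>i | i < length (heights 0 p) \<and> P (Suc i). heights 0 p ! i)"
proof -
  let ?q = "heights 0 p"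
  have "(a, b) \<in> cells_below p \<longleftrightarrow>
      (\<exists>i v. (\<exists>k<length p. p ! k = Right \<and> x_after p k = i \<and> 0 + y_after p k = v) \<and>
        a = Suc i \<and> b \<in> {1..v})" for a b
    by (auto simp: cells_below_def)
  then have mem: "(a, b) \<in> cells_below p \<longleftrightarrow>
      (\<exists>i. i < length ?q \<and> a = Suc i \<and> b \<in> {1..?q ! i})" for a b
    unfolding nth_heights_iff[symmetric] by blast
  have "{c \<in> cells_below p. P (fst c)} =
      (\<lambda>(i, j). (Suc i, j)) ` (SIGMA i:{i. i < length ?q \<and> P (Suc i)}. {1..?q ! i})"
    by (force simp: mem)
  also have "card \<dots> = (\<Sum>i | i < length ?q \<and> P (Suc i). ?q ! i)"
    by (subst card_image) (auto simp: inj_on_def)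
  finally show ?thesis .
qed

text \<open>Columns are numbered from 1 and list positions from 0, so black columns sit at even positions
  and carry the positive sign.\<close>

lemma black_minus_white:
  "int (black column_alternating p) - int (white column_alternating p) = alt_sum (heights 0 p)"
proof -
  have "column_alternating c = Black \<longleftrightarrow> odd (fst c)" "column_alternating c = White \<longleftrightarrow> even (fst c)" for c
    by (simp_all add: column_alternating_def)
  then show ?thesis
    using card_cells_below_columns[of p odd] card_cells_below_columns[of p even]
    by (simp add: black_def white_def alt_sum_eq_diff)
qed

fun doubled :: "'a list \<Rightarrow> 'a list" where
  "doubled [] = []"
| "doubled (v # q) = v # v # doubled q"

lemma length_doubled [simp]: "length (doubled q) = 2 * length q"
  by (induction q) auto

lemma set_doubled [simp]: "set (doubled q) = set q"
  by (induction q) auto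

lemma sorted_doubled [simp]: "sorted (doubled q) \<longleftrightarrow> sorted q"
  by (induction q) auto

lemma nth_doubled: "i < 2 * length q \<Longrightarrow> doubled q ! i = q ! (i div 2)"
proof (induction q arbitrary: i)
  case (Cons v q)
  show ?case
  proof (cases "i < 2")
    case True
    then show ?thesis by (cases i) auto
  next
    case False
    then obtain j where "i = Suc (Suc j)"
      by (metis add_2_eq_Suc le_Suc_ex not_less)
    then show ?thesis using Cons by simp
  qed
qed simp

lemma inj_doubled: "inj doubled"
proof (rule injI)
  show "doubled q = doubled q' \<Longrightarrow> q = q'" for q q' :: "'a list"
    by (induction q arbitrary: q') (case_tac q'; force)+
qed

lemma alt_sum_doubled: "alt_sum (doubled q) = 0"
  by (induction q) auto

text \<open>The alternating sum splits into differences \<open>u - v\<close> of consecutive entries with \<open>u \<le> v\<close>. All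
  are nonpositive, so their sum vanishes only if each of them does.\<close>

lemma alt_sum_sorted_even_length:
  assumes "sorted q" "even (length q)"
  shows "alt_sum q \<le> 0 \<and> (alt_sum q = 0 \<longrightarrow> q \<in> range doubled)"
  using assms
proof (induction q rule: induct_list012)
  case 1
  show ?case by (metis alt_sum.simps(1) doubled.simps(1) order_refl rangeI)
next
  case (3 u v q)
  then have IH: "alt_sum q \<le> 0" "alt_sum q = 0 \<longrightarrow> q \<in> range doubled" and "u \<le> v"
    by auto
  have "u # v # q \<in> range doubled" if "alt_sum (u # v # q) = 0"
  proof -
    have "u = v" "alt_sum q = 0" using that IH(1) \<open>u \<le> v\<close> by auto
    then obtain q' where "q = doubled q'" using IH(2) by blast
    with \<open>u = v\<close> have "u # v # q = doubled (u # q')" by simp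
    then show ?thesis by blast
  qed
  with IH \<open>u \<le> v\<close> show ?case by simp
qed simp

text \<open>A common value at positions \<open>2j\<close> and \<open>2j + 1\<close> is bounded by the smaller bound \<open>2j + r\<close>, so
  halving the length doubles the slope.\<close>

lemma balanced_staircase_even:
  "{q \<in> staircase_seqs 1 r (2 * m). alt_sum q = 0} = doubled ` staircase_seqs 2 r m"
proof (intro equalityI subsetI)
  fix q assume q: "q \<in> {q \<in> staircase_seqs 1 r (2 * m). alt_sum q = 0}"
  then obtain q' where q': "q = doubled q'"
    using alt_sum_sorted_even_length[of q] by (auto simp: staircase_seqs_def)
  have "q' ! j < 2 * j + r" if "j < m" for j
  proof -
    have "q ! (2 * j) < 2 * j + r" using q that by (auto simp: staircase_seqs_def)
    with that q q' show ?thesis by (auto simp: nth_doubled staircase_seqs_def)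
  qed
  with q q' show "q \<in> doubled ` staircase_seqs 2 r m"
    by (auto simp: staircase_seqs_def)
next
  fix q assume "q \<in> doubled ` staircase_seqs 2 r m"
  then obtain q' where q': "q = doubled q'" "q' \<in> staircase_seqs 2 r m" by blast
  have "q ! i < i + r" if "i < 2 * m" for i
  proof -
    have "i div 2 < m" using that by simp
    then have "q' ! (i div 2) < 2 * (i div 2) + r" using q' by (auto simp: staircase_seqs_def)
    moreover have "q ! i = q' ! (i div 2)"
      using that q' by (simp add: nth_doubled staircase_seqs_def)
    moreover have "2 * (i div 2) \<le> i" by simp
    ultimately show ?thesis by linarith
  qed
  with q' show "q \<in> {q \<in> staircase_seqs 1 r (2 * m). alt_sum q = 0}"
    by (auto simp: staircase_seqs_def alt_sum_doubled)
qed

text \<open>The first height is forced to be 0 and does not affect the balance. Removing it reduces to even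
  length, with the staircase raised by one.\<close>

lemma balanced_staircase_odd:
  "{q \<in> staircase_seqs 1 1 (2 * m + 1). alt_sum q = 0} = (\<lambda>q. 0 # doubled q) ` staircase_seqs 2 2 m"
proof -
  have "staircase_seqs 1 1 (2 * m + 1) = (#) 0 ` staircase_seqs 1 2 (2 * m)"
    using staircase_seqs_Suc[of 1 0 "2 * m"] by (simp add: staircase_seqs_bound_0 numeral_2_eq_2)
  then have "{q \<in> staircase_seqs 1 1 (2 * m + 1). alt_sum q = 0} =
      (#) 0 ` {q \<in> staircase_seqs 1 2 (2 * m). alt_sum q = 0}"
    by auto
  then show ?thesis by (simp only: balanced_staircase_even image_image)
qed

lemma card_balanced_dyck_paths_alt_sum:
  "card (balanced_dyck_paths column_alternating n) = card {q \<in> staircase_seqs 1 1 n. alt_sum q = 0}"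
proof (rule bij_betw_same_card)
  have "balanced_dyck_paths column_alternating n = {p \<in> dyck_paths n. alt_sum (heights 0 p) = 0}"
    unfolding balanced_dyck_paths_def black_minus_white[symmetric] by simp
  then show "bij_betw (heights 0) (balanced_dyck_paths column_alternating n)
      {q \<in> staircase_seqs 1 1 n. alt_sum q = 0}"
    using bij_betw_heights[of n] by (auto simp: bij_betw_def inj_on_def)
qed

lemma card_dyck_paths: "(n + 1) * card (dyck_paths n) = (2 * n) choose n"
  using card_staircase_seqs_reduced[of 1 n 0] bij_betw_same_card[OF bij_betw_heights[of n]]
  by (simp add: mult_2)

lemma card_balanced_even:
  "(2 * m + 1) * card (balanced_dyck_paths column_alternating (2 * m)) = (3 * m) choose m"
proof -
  have "card (doubled ` staircase_seqs 2 1 m) = card (staircase_seqs 2 1 m)"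
    by (intro card_image inj_on_subset[OF inj_doubled]) simp
  then show ?thesis
    using card_staircase_seqs_reduced[of 2 m 0]
    by (simp add: card_balanced_dyck_paths_alt_sum balanced_staircase_even[simplified])
qed

lemma card_balanced_odd:
  "(m + 1) * card (balanced_dyck_paths column_alternating (2 * m + 1)) = (3 * m + 1) choose m"
proof -
  have "inj (\<lambda>q. (0::nat) # doubled q)"
    using inj_doubled by (auto simp: inj_def)
  then have "card ((\<lambda>q. 0 # doubled q) ` staircase_seqs 2 2 m) = card (staircase_seqs 2 2 m)"
    by (rule card_image[OF inj_on_subset[OF _ subset_UNIV]])
  moreover have "2 * ((m + 1) * card (staircase_seqs 2 2 m)) = 2 * ((3 * m + 1) choose m)"
    using card_staircase_seqs_reduced[of 2 m 1] unfolding Suc_1 by (simp add: algebra_simps)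
  ultimately show ?thesis
    by (simp only: card_balanced_dyck_paths_alt_sum balanced_staircase_odd mult_cancel1) simp
qed


section \<open>Asymptotic proportion\<close>

lemma Gamma_reflection_real:
  fixes x :: real
  shows "Gamma x * Gamma (1 - x) = pi / sin (pi * x)"
proof -
  have "complex_of_real (Gamma x * Gamma (1 - x)) = complex_of_real (pi / sin (pi * x))"
    using Gamma_reflection_complex[of "of_real x"]
    by (simp add: Gamma_complex_of_real[symmetric] sin_of_real[symmetric])
  then show ?thesis by (rule of_real_eq_iff[THEN iffD1])
qed

text \<open>In \<open>\<Gamma>(z) = lim n! n\<^sup>z / (z(z+1)\<dots>(z+n))\<close>, the product of the approximants for \<open>z\<close> and \<open>1 - z\<close> has
  the numerator \<open>n!\<^sup>2 n\<close>, whatever \<open>z\<close> is. So it cancels when the products for \<open>y\<close> and \<open>x\<close> are divided, and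
  the reflection formula evaluates the limit.\<close>

lemma pochhammer_reflection_ratio_tendsto:
  fixes x y :: real
  assumes "0 < x" "x < 1" "0 < y" "y < 1"
  shows "(\<lambda>n. (pochhammer x n * pochhammer (1 - x) n) / (pochhammer y n * pochhammer (1 - y) n))
           \<longlonglongrightarrow> sin (pi * x) / sin (pi * y)"
proof (rule LIMSEQ_imp_Suc)
  have sin_pos: "0 < sin (pi * z)" if "0 < z" "z < 1" for z
    using that by (intro sin_gt_zero) auto
  have tendsto: "(\<lambda>n. Gamma_series z n * Gamma_series (1 - z) n) \<longlonglongrightarrow> pi / sin (pi * z)" for z :: real
    unfolding Gamma_reflection_real[symmetric] by (intro tendsto_intros)
  have "(\<lambda>n. (Gamma_series y n * Gamma_series (1 - y) n) / (Gamma_series x n * Gamma_series (1 - x) n))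
      \<longlonglongrightarrow> (pi / sin (pi * y)) / (pi / sin (pi * x))"
    using sin_pos[of x] assms by (intro tendsto_divide tendsto) auto
  also have "(pi / sin (pi * y)) / (pi / sin (pi * x)) = sin (pi * x) / sin (pi * y)"
    by simp
  also have "(\<lambda>n. (Gamma_series y n * Gamma_series (1 - y) n) / (Gamma_series x n * Gamma_series (1 - x) n)) =
      (\<lambda>n. (pochhammer x (Suc n) * pochhammer (1 - x) (Suc n)) /
            (pochhammer y (Suc n) * pochhammer (1 - y) (Suc n)))"
  proof
    fix n
    have "Gamma_series z n * Gamma_series (1 - z) n =
        fact n ^ 2 * exp (ln (real n)) / (pochhammer z (Suc n) * pochhammer (1 - z) (Suc n))" for z :: real
    proof -
      have "exp (z * ln (real n)) * exp ((1 - z) * ln (real n)) = exp (ln (real n))"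
        by (simp add: exp_add[symmetric] algebra_simps)
      then show ?thesis
        by (simp add: Gamma_series_def power2_eq_square mult_ac)
    qed
    (* The simp rule for exp (ln _) would require a positive argument and split off n = 0, where
       exp (ln 0) = 1 cancels just as well. *)
    then show "(Gamma_series y n * Gamma_series (1 - y) n) / (Gamma_series x n * Gamma_series (1 - x) n) =
      (pochhammer x (Suc n) * pochhammer (1 - x) (Suc n)) /
            (pochhammer y (Suc n) * pochhammer (1 - y) (Suc n))"
      by (simp del: exp_ln)
  qed
  finally show "(\<lambda>n. (pochhammer x (Suc n) * pochhammer (1 - x) (Suc n)) /
            (pochhammer y (Suc n) * pochhammer (1 - y) (Suc n)))
      \<longlonglongrightarrow> sin (pi * x) / sin (pi * y)" .
qed

lemma balanced_proportion_even:
  "balanced_proportion column_alternating (2 * m) =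
     (fact (3 * m) * fact (2 * m)) / (fact m * fact (4 * m))"
proof -
  have "real (2 * m + 1) * real (card (balanced_dyck_paths column_alternating (2 * m))) = real ((3 * m) choose m)"
    by (simp only: card_balanced_even of_nat_mult[symmetric])
  moreover have "real (2 * m + 1) * real (card (dyck_paths (2 * m))) = real ((2 * (2 * m)) choose (2 * m))"
    by (simp only: card_dyck_paths of_nat_mult[symmetric])
  ultimately have "balanced_proportion column_alternating (2 * m) =
      real ((3 * m) choose m) / real ((2 * (2 * m)) choose (2 * m))"
    unfolding balanced_proportion_def by (metis mult_divide_mult_cancel_left of_nat_eq_0_iff add_is_0 zero_neq_one)
  also have "\<dots> = (fact (3 * m) * fact (2 * m)) / (fact m * fact (4 * m))"
    by (simp add: binomial_fact field_simps)
  finally show ?thesis .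
qed

lemma balanced_proportion_odd:
  "balanced_proportion column_alternating (2 * m + 1) =
     (3 * real m + 1) / (4 * real m + 1) * balanced_proportion column_alternating (2 * m)"
proof -
  have "2 * (real (m + 1) * real (card (balanced_dyck_paths column_alternating (2 * m + 1)))) =
      2 * real ((3 * m + 1) choose m)"
    by (simp only: card_balanced_odd of_nat_mult[symmetric])
  moreover have "real ((2 * m + 1) + 1) * real (card (dyck_paths (2 * m + 1))) =
      real ((2 * (2 * m + 1)) choose (2 * m + 1))"
    by (simp only: card_dyck_paths of_nat_mult[symmetric])
  ultimately have "real (2 * m + 2) * real (card (balanced_dyck_paths column_alternating (2 * m + 1))) =
      2 * real ((3 * m + 1) choose m)"
    "real (2 * m + 2) * real (card (dyck_paths (2 * m + 1))) = real ((4 * m + 2) choose (2 * m + 1))"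
    by (simp_all add: algebra_simps)
  then have "balanced_proportion column_alternating (2 * m + 1) =
      2 * real ((3 * m + 1) choose m) / real ((4 * m + 2) choose (2 * m + 1))"
    unfolding balanced_proportion_def
    by (metis mult_divide_mult_cancel_left of_nat_eq_0_iff add_is_0 zero_neq_numeral)
  also have "real ((3 * m + 1) choose m) = (3 * real m + 1) * fact (3 * m) / (fact m * ((2 * real m + 1) * fact (2 * m)))"
  proof -
    have "3 * m + 1 - m = Suc (2 * m)" by simp
    then show ?thesis by (simp add: binomial_fact algebra_simps)
  qed
  also have "real ((4 * m + 2) choose (2 * m + 1)) =
      (4 * real m + 2) * (4 * real m + 1) * fact (4 * m) / ((2 * real m + 1) * fact (2 * m)) ^ 2"
  proof -
    have "real ((4 * m + 2) choose (2 * m + 1)) =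
        fact (4 * m + 2) / (fact (2 * m + 1) * fact (4 * m + 2 - (2 * m + 1)))"
      by (rule binomial_fact) simp
    also have "4 * m + 2 - (2 * m + 1) = 2 * m + 1" by simp
    also have "fact (2 * m + 1) = (2 * real m + 1) * fact (2 * m)"
      by (simp add: add.commute)
    also have "fact (4 * m + 2) = (4 * real m + 2) * (4 * real m + 1) * fact (4 * m)"
      by (simp add: eval_nat_numeral algebra_simps)
    finally show ?thesis by (simp only: power2_eq_square)
  qed
  also have "2 * ((3 * real m + 1) * fact (3 * m) / (fact m * ((2 * real m + 1) * fact (2 * m)))) /
      ((4 * real m + 2) * (4 * real m + 1) * fact (4 * m) / ((2 * real m + 1) * fact (2 * m)) ^ 2) =
      (3 * real m + 1) / (4 * real m + 1) * ((fact (3 * m) * fact (2 * m)) / (fact m * fact (4 * m)))"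
  proof -
    define c where "c = 2 * real m + 1"
    have "4 * real m + 2 = 2 * c" "c \<noteq> 0" by (simp_all add: c_def)
    then show ?thesis unfolding c_def[symmetric]
      by (simp add: power2_eq_square)
  qed
  finally show ?thesis unfolding balanced_proportion_even .
qed

text \<open>Both sides are 1 at \<open>m = 0\<close> and grow by the same factor: passing from \<open>m\<close> to \<open>m + 1\<close> multiplies the
  quotient of factorials by \<open>3(3m+1)(3m+2) / (4(4m+1)(4m+3))\<close> after cancellation.\<close>

lemma balanced_proportion_pochhammer:
  "balanced_proportion column_alternating (2 * m) = (27 / 64) ^ m *
     ((pochhammer (1/3) m * pochhammer (1 - 1/3) m) / (pochhammer (1/4) m * pochhammer (1 - 1/4) m))"
  unfolding balanced_proportion_even
proof (induction m)
  case (Suc m)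
  define x where "x = real m"
  have "x \<ge> 0" by (simp add: x_def)
  have fact_steps: "fact (Suc m) = (x + 1) * fact m"
    "fact (2 * Suc m) = (2 * x + 2) * (2 * x + 1) * fact (2 * m)"
    "fact (3 * Suc m) = (3 * x + 3) * (3 * x + 2) * (3 * x + 1) * fact (3 * m)"
    "fact (4 * Suc m) = (4 * x + 4) * (4 * x + 3) * (4 * x + 2) * (4 * x + 1) * fact (4 * m)"
    by (simp_all add: x_def eval_nat_numeral algebra_simps)
  have factor: "((3 * x + 3) * (3 * x + 2) * (3 * x + 1)) * ((2 * x + 2) * (2 * x + 1)) /
        ((x + 1) * ((4 * x + 4) * (4 * x + 3) * (4 * x + 2) * (4 * x + 1))) =
      27 * ((1/3 + x) * (1 - 1/3 + x)) / (64 * ((1/4 + x) * (1 - 1/4 + x)))"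
  proof -
    have "27 * ((1/3 + x) * (1 - 1/3 + x)) = 3 * (3 * x + 1) * (3 * x + 2)"
      "64 * ((1/4 + x) * (1 - 1/4 + x)) = 4 * (4 * x + 1) * (4 * x + 3)"
      by (simp_all add: field_simps)
    moreover have "x + 1 \<noteq> 0" "4 * x + 1 \<noteq> 0" "4 * x + 2 \<noteq> 0" "4 * x + 3 \<noteq> 0" "4 * x + 4 \<noteq> 0"
      using \<open>x \<ge> 0\<close> by linarith+
    ultimately show ?thesis
      by (simp add: frac_eq_eq) (simp add: algebra_simps)
  qed
  have "(fact (3 * Suc m) * fact (2 * Suc m)) / (fact (Suc m) * fact (4 * Suc m)) =
      (((3 * x + 3) * (3 * x + 2) * (3 * x + 1)) * ((2 * x + 2) * (2 * x + 1)) /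
        ((x + 1) * ((4 * x + 4) * (4 * x + 3) * (4 * x + 2) * (4 * x + 1)))) *
      ((fact (3 * m) * fact (2 * m)) / (fact m * fact (4 * m)))"
    unfolding fact_steps times_divide_times_eq by (simp only: mult_ac)
  also have "\<dots> = (27 * ((1/3 + x) * (1 - 1/3 + x)) / (64 * ((1/4 + x) * (1 - 1/4 + x)))) *
      ((27 / 64) ^ m *
       ((pochhammer (1/3) m * pochhammer (1 - 1/3) m) / (pochhammer (1/4) m * pochhammer (1 - 1/4) m)))"
    unfolding factor Suc.IH ..
  also have "\<dots> = (27 / 64) ^ Suc m *
      ((pochhammer (1/3) (Suc m) * pochhammer (1 - 1/3) (Suc m)) /
       (pochhammer (1/4) (Suc m) * pochhammer (1 - 1/4) (Suc m)))"
    unfolding pochhammer_Suc x_def[symmetric] power_Suc times_divide_times_eq times_divide_eq_right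
      times_divide_eq_left divide_divide_eq_left by (simp only: mult_ac)
  finally show ?case .
qed simp

lemma balanced_proportion_even_asymp:
  "(\<lambda>m. balanced_proportion column_alternating (2 * m) / (27 / 64) ^ m) \<longlonglongrightarrow> sqrt (3 / 2)"
proof -
  have "sin (pi * (1/3)) / sin (pi * (1/4)) = sqrt (3 / 2)"
    by (simp add: sin_60 sin_45 real_sqrt_divide)
  then show ?thesis
    using pochhammer_reflection_ratio_tendsto[of "1/3" "1/4"]
    by (simp add: balanced_proportion_pochhammer)
qed

theorem theorem2:
  fixes \<alpha> :: real and \<beta> :: "nat \<Rightarrow> real"
  defines "\<alpha> \<equiv> 3 * sqrt 3 / 8"
    and "\<beta> \<equiv> (\<lambda>n. if even n then sqrt (3 / 2) else sqrt 2)"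
  shows "(\<forall>n \<ge> 1. \<forall>m.
            (n = 2 * m \<longrightarrow>
              real (card (balanced_dyck_paths column_alternating n)) =
                1 / (2 * real m + 1) * real ((3 * m) choose m)) \<and>
            (n = 2 * m + 1 \<longrightarrow>
              real (card (balanced_dyck_paths column_alternating n)) =
                1 / (real m + 1) * real ((3 * m + 1) choose m))) \<and>
         (\<lambda>n. balanced_proportion column_alternating n / (\<beta> n * \<alpha> ^ n)) \<longlonglongrightarrow> 1"
proof (intro conjI allI impI)
  fix n m :: nat
  show "real (card (balanced_dyck_paths column_alternating n)) =
      1 / (2 * real m + 1) * real ((3 * m) choose m)" if "n = 2 * m"
    unfolding that card_balanced_even[symmetric] by (simp add: field_simps)
  show "real (card (balanced_dyck_paths column_alternating n)) =
      1 / (real m + 1) * real ((3 * m + 1) choose m)" if "n = 2 * m + 1"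
    unfolding that card_balanced_odd[symmetric] by (simp add: field_simps)
next
  have \<alpha>_sq: "\<alpha> ^ (2 * m) = (27 / 64) ^ m" for m
    by (simp add: \<alpha>_def power_mult power_divide power_mult_distrib)
  have even_lim: "(\<lambda>m. balanced_proportion column_alternating (2 * m) / (27 / 64) ^ m / sqrt (3 / 2)) \<longlonglongrightarrow> 1"
    using tendsto_divide[OF balanced_proportion_even_asymp tendsto_const, of "sqrt (3 / 2)"] by simp
  have "(\<lambda>m. (3 * real m + 1) / (4 * real m + 1)) \<longlonglongrightarrow> 3 / 4"
    by real_asymp
  then have odd_lim: "(\<lambda>m. 4 / 3 * ((3 * real m + 1) / (4 * real m + 1)) *
      (balanced_proportion column_alternating (2 * m) / (27 / 64) ^ m / sqrt (3 / 2))) \<longlonglongrightarrow> 4 / 3 * (3 / 4) * 1"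
    by (intro tendsto_mult tendsto_const even_lim)
  (* The two constants for odd n match: the extra power of \<alpha> absorbs the limit 3/4. *)
  have odd_const: "sqrt 2 * \<alpha> = 3 / 4 * sqrt (3 / 2)"
    by (simp add: \<alpha>_def real_sqrt_divide field_simps)
  show "(\<lambda>n. balanced_proportion column_alternating n / (\<beta> n * \<alpha> ^ n)) \<longlonglongrightarrow> 1"
  proof (rule limseq_even_odd)
    show "(\<lambda>m. balanced_proportion column_alternating (2 * m) / (\<beta> (2 * m) * \<alpha> ^ (2 * m))) \<longlonglongrightarrow> 1"
      unfolding \<alpha>_sq using even_lim by (simp add: \<beta>_def mult.commute)
    have "balanced_proportion column_alternating (2 * m + 1) / (\<beta> (2 * m + 1) * \<alpha> ^ (2 * m + 1)) =
        4 / 3 * ((3 * real m + 1) / (4 * real m + 1)) *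
        (balanced_proportion column_alternating (2 * m) / (27 / 64) ^ m / sqrt (3 / 2))" for m
    proof -
      have regroup: "c * P / (3 / 4 * s * t) = 4 / 3 * c * (P / t / s)" for c P s t :: real
        by (simp add: mult_ac)
      have "\<beta> (2 * m + 1) * \<alpha> ^ (2 * m + 1) = (sqrt 2 * \<alpha>) * (27 / 64) ^ m"
        by (simp add: \<beta>_def \<alpha>_sq)
      then have scale: "\<beta> (2 * m + 1) * \<alpha> ^ (2 * m + 1) = 3 / 4 * sqrt (3 / 2) * (27 / 64) ^ m"
        unfolding odd_const .
      show ?thesis
        unfolding scale balanced_proportion_odd by (rule regroup)
    qed
    then show "(\<lambda>m. balanced_proportion column_alternating (2 * m + 1) /
        (\<beta> (2 * m + 1) * \<alpha> ^ (2 * m + 1))) \<longlonglongrightarrow> 1"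
      using odd_lim by simp
  qed
qed

end
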